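(* Let $\mathbf c\in\mathbb Z_{>0}^n$ with $c_1\ge\cdots\ge c_n$, let $r^2\in\mathbb Z_{\ge0}$, and let $\mathbf x$ be any optimal solution of $$\max\{\mathbf c^\top\mathbf x:\ \mathbf x\in\mathbb Z_{\ge0}^n,\ \lVert\mathbf x\rVert^2\le r^2\}.$$ For $k\in\{1,\dots,n\}$ put $R_k=\sqrt{r^2-\sum_{j<k}x_j^2}$, $\mathbf c_{k:n}=(c_k,\dots,c_n)$, $s_k=\lVert\mathbf c_{k:n}\rVert$, and $t_k^*=c_kR_k/s_k$. Then for every $k\in\{1,\dots,n\}$, $$|x_k-t_k^*|\le\sqrt{\frac{2R_k\lVert\mathbf c_{k:n}\rVert_1}{s_k}}\le\sqrt2\,\sqrt{R_k}\,(n-k+1)^{1/4}.$$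
   Context: $\lVert\cdot\rVert$ is the Euclidean norm and $\lVert\cdot\rVert_1$ is the $\ell_1$ norm. *)

theory Defs
  imports "HOL-Analysis.Analysis"
begin

text \<open>
  A vector in \<open>\<int>\<^sup>n\<close> is a function \<open>nat \<Rightarrow> int\<close> of which only the entries at the indices
  \<open>1, \<dots>, n\<close> matter. \<open>L2_set f A\<close> is the Euclidean norm of the subvector of \<open>f\<close> indexed by \<open>A\<close>.
\<close>

definition feasible :: "nat \<Rightarrow> real \<Rightarrow> (nat \<Rightarrow> int) \<Rightarrow> bool" where
  "feasible n r x \<longleftrightarrow>
     x \<in> {1..n} \<rightarrow> {0..} \<and> (L2_set (\<lambda>j. real_of_int (x j)) {1..n})\<^sup>2 \<le> r\<^sup>2"

definition optimal :: "nat \<Rightarrow> (nat \<Rightarrow> int) \<Rightarrow> real \<Rightarrow> (nat \<Rightarrow> int) \<Rightarrow> bool" where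
  "optimal n c r = is_arg_max (\<lambda>x. \<Sum>j=1..n. c j * x j) (feasible n r)"

definition residual_radius :: "real \<Rightarrow> (nat \<Rightarrow> int) \<Rightarrow> nat \<Rightarrow> real" where
  "residual_radius r x k = sqrt (r\<^sup>2 - (\<Sum>j\<in>{1..<k}. (real_of_int (x j))\<^sup>2))"

definition tail_norm :: "nat \<Rightarrow> (nat \<Rightarrow> int) \<Rightarrow> nat \<Rightarrow> real" where
  "tail_norm n c k = L2_set (\<lambda>j. real_of_int (c j)) {k..n}"

definition tail_norm1 :: "nat \<Rightarrow> (nat \<Rightarrow> int) \<Rightarrow> nat \<Rightarrow> real" where
  "tail_norm1 n c k = (\<Sum>j=k..n. \<bar>real_of_int (c j)\<bar>)"

definition t_star :: "nat \<Rightarrow> (nat \<Rightarrow> int) \<Rightarrow> real \<Rightarrow> (nat \<Rightarrow> int) \<Rightarrow> nat \<Rightarrow> real" where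
  "t_star n c r x k = real_of_int (c k) * residual_radius r x k / tail_norm n c k"

end

theory Submission
  imports Defs
begin

text \<open>
  Rescale the tail of \<open>c\<close> to Euclidean norm \<open>R\<^sub>k\<close>, giving \<open>u = (R\<^sub>k / s\<^sub>k) c\<^sub>k\<^sub>:\<^sub>n\<close>, whose first entry is
  \<open>t\<^sub>k\<^sup>*\<close>. Replacing the tail of \<open>x\<close> by the entrywise floor of \<open>u\<close> keeps it feasible, so optimality
  gives \<open>\<langle>c, x\<rangle> \<ge> R\<^sub>k s\<^sub>k - \<parallel>c\<parallel>\<^sub>1\<close> on the tail. As the tail of \<open>x\<close> also has norm at most \<open>R\<^sub>k\<close>,
  expanding \<open>\<parallel>x - u\<parallel>\<^sup>2\<close> bounds it by \<open>2 R\<^sub>k \<parallel>c\<parallel>\<^sub>1 / s\<^sub>k\<close>. The second bound is Cauchy--Schwarz.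
\<close>

text \<open>The scaled vector \<open>c j * R / s\<close> has squared norm exactly
  \<open>R\<^sup>2\<close>, so the two square terms of the expansion give at most
  \<open>2 * R\<^sup>2\<close>. The cross term takes this back except for the slack
  \<open>N\<close>, scaled by \<open>2 * R / s\<close>.\<close>

lemma sum_sq_dist_scaled_le:
  fixes c x :: "'a \<Rightarrow> real"
  assumes s: "s > 0" and R: "R \<ge> 0"
    and c_sq: "(\<Sum>j\<in>A. (c j)\<^sup>2) = s\<^sup>2"
    and x_sq: "(\<Sum>j\<in>A. (x j)\<^sup>2) \<le> R\<^sup>2"
    and cx: "R * s - N \<le> (\<Sum>j\<in>A. c j * x j)"
  shows "(\<Sum>j\<in>A. (x j - c j * R / s)\<^sup>2) \<le> 2 * R * N / s"
proof -
  have "(\<Sum>j\<in>A. (x j - c j * R / s)\<^sup>2)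
      = (\<Sum>j\<in>A. (x j)\<^sup>2 - 2 * (R / s) * (c j * x j) + (R / s)\<^sup>2 * (c j)\<^sup>2)"
    by (intro sum.cong refl) (simp add: power2_eq_square algebra_simps)
  also have "\<dots> = (\<Sum>j\<in>A. (x j)\<^sup>2) - 2 * (R / s) * (\<Sum>j\<in>A. c j * x j) + (R / s)\<^sup>2 * s\<^sup>2"
    by (simp only: sum.distrib sum_subtractf sum_distrib_left [symmetric] c_sq)
  also have "(R / s)\<^sup>2 * s\<^sup>2 = R\<^sup>2"
    using s by (simp add: power_divide)
  also have "(\<Sum>j\<in>A. (x j)\<^sup>2) - 2 * (R / s) * (\<Sum>j\<in>A. c j * x j) + R\<^sup>2
      \<le> R\<^sup>2 - 2 * (R / s) * (R * s - N) + R\<^sup>2"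
    using R s x_sq cx by (intro add_mono diff_mono mult_left_mono) auto
  also have "\<dots> = 2 * R * N / s"
    using s by (simp add: field_simps power2_eq_square)
  finally show ?thesis .
qed

lemma sum_abs_le_sqrt_card_mult_L2_set:
  "(\<Sum>j\<in>A. \<bar>f j\<bar>) \<le> sqrt (card A) * L2_set f A"
  using L2_set_mult_ineq [of "\<lambda>_. 1" f A] by (simp add: L2_set_def)

lemma sum_split_at:
  fixes f :: "nat \<Rightarrow> 'a::comm_monoid_add"
  assumes "k \<in> {1..n}"
  shows "(\<Sum>j=1..n. f j) = (\<Sum>j\<in>{1..<k}. f j) + (\<Sum>j=k..n. f j)"
proof -
  have "{1..n} = {1..<k} \<union> {k..n}"
    using assms by auto
  then show ?thesis
    by (simp add: sum.union_disjoint ivl_disj_int)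
qed

lemma feasible_iff:
  "feasible n r x \<longleftrightarrow>
     (\<forall>j\<in>{1..n}. 0 \<le> x j) \<and> (\<Sum>j=1..n. (real_of_int (x j))\<^sup>2) \<le> r\<^sup>2"
  by (auto simp: feasible_def L2_set_def sum_nonneg)

context
  fixes n k :: nat and r :: real and x :: "nat \<Rightarrow> int"
  assumes feas: "feasible n r x" and k: "k \<in> {1..n}"
begin

lemma tail_sum_sq_le: "(\<Sum>j=k..n. (real_of_int (x j))\<^sup>2) \<le> r\<^sup>2 - (\<Sum>j\<in>{1..<k}. (real_of_int (x j))\<^sup>2)"
  using feas sum_split_at [OF k, of "\<lambda>j. (real_of_int (x j))\<^sup>2"] by (auto simp: feasible_iff)

text \<open>Since \<open>sqrt\<close> is negative on negative reals, both claims need a nonnegative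
  radicand. Feasibility gives it: the radicand dominates the sum of squares over the tail.\<close>

lemma residual_radius_sq:
  "(residual_radius r x k)\<^sup>2 = r\<^sup>2 - (\<Sum>j\<in>{1..<k}. (real_of_int (x j))\<^sup>2)"
  and residual_radius_nonneg: "residual_radius r x k \<ge> 0"
proof -
  have "0 \<le> r\<^sup>2 - (\<Sum>j\<in>{1..<k}. (real_of_int (x j))\<^sup>2)"
    by (rule order_trans [OF _ tail_sum_sq_le]) (simp add: sum_nonneg)
  then show "(residual_radius r x k)\<^sup>2 = r\<^sup>2 - (\<Sum>j\<in>{1..<k}. (real_of_int (x j))\<^sup>2)"
    and "residual_radius r x k \<ge> 0"
    by (simp_all add: residual_radius_def)
qed

text \<open>The kept prefix uses exactly \<open>r\<^sup>2\<close> minus the squared residual radius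
  of the budget, which leaves the rest for the new tail.\<close>

lemma feasible_replace_tail:
  assumes nonneg: "\<forall>j\<in>{k..n}. 0 \<le> y j"
    and sq: "(\<Sum>j=k..n. (real_of_int (y j))\<^sup>2) \<le> (residual_radius r x k)\<^sup>2"
  shows "feasible n r (\<lambda>j. if j < k then x j else y j)"
  using feas nonneg sq sum_split_at [OF k, of "\<lambda>j. (real_of_int (if j < k then x j else y j))\<^sup>2"]
  by (auto simp: feasible_iff residual_radius_sq)

end

text \<open>Splice \<open>y\<close> onto the prefix of \<open>x\<close> and compare objective
  values: the common prefix cancels, so the tail of an optimum solves the residual problem.\<close>

lemma optimal_tail:
  assumes opt: "optimal n c r x" and k: "k \<in> {1..n}"
    and y: "\<forall>j\<in>{k..n}. 0 \<le> y j"
      "(\<Sum>j=k..n. (real_of_int (y j))\<^sup>2) \<le> (residual_radius r x k)\<^sup>2"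
  shows "(\<Sum>j=k..n. c j * y j) \<le> (\<Sum>j=k..n. c j * x j)"
proof -
  have "feasible n r x"
    using opt by (simp add: optimal_def is_arg_max_def)
  from feasible_replace_tail [OF this k y] opt
  have "(\<Sum>j=1..n. c j * (if j < k then x j else y j)) \<le> (\<Sum>j=1..n. c j * x j)"
    by (auto simp: optimal_def is_arg_max_def not_less)
  then show ?thesis
    by (simp add: sum_split_at [OF k] del: One_nat_def)
qed

text \<open>The scaled vector \<open>u\<close> attains the objective value \<open>R * s\<close>.
  Rounding down costs at most 1 per entry, weighted by \<open>c j\<close>, hence at most
  \<open>tail_norm1\<close> in total.\<close>

lemma optimal_tail_ge:
  assumes c_pos: "\<forall>j\<in>{1..n}. c j > 0" and opt: "optimal n c r x" and k: "k \<in> {1..n}"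
    and s: "tail_norm n c k > 0"
  shows "residual_radius r x k * tail_norm n c k - tail_norm1 n c k
    \<le> (\<Sum>j=k..n. real_of_int (c j) * real_of_int (x j))"
proof -
  let ?R = "residual_radius r x k" and ?s = "tail_norm n c k"
  define u where "u j = real_of_int (c j) * ?R / ?s" for j
  have feas: "feasible n r x"
    using opt by (simp add: optimal_def is_arg_max_def)
  have c0: "c j > 0" if "j \<in> {k..n}" for j
    using c_pos k that by auto
  have u0: "u j \<ge> 0" if "j \<in> {k..n}" for j
    using c0 [OF that] residual_radius_nonneg [OF feas k] s by (simp add: u_def)
  have c_sq: "(\<Sum>j=k..n. (real_of_int (c j))\<^sup>2) = ?s\<^sup>2"
    by (simp add: tail_norm_def L2_set_def sum_nonneg)
  \<comment> \<open>As \<open>u j\<close> is nonnegative, so is its floor, and squaring preserves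
    the order.\<close>
  have "(\<Sum>j=k..n. (real_of_int \<lfloor>u j\<rfloor>)\<^sup>2) \<le> (\<Sum>j=k..n. (u j)\<^sup>2)"
    using u0 by (intro sum_mono power_mono) auto
  also have "\<dots> = (?R / ?s)\<^sup>2 * ?s\<^sup>2"
    unfolding c_sq [symmetric] sum_distrib_left
    by (intro sum.cong refl) (simp add: u_def power2_eq_square)
  also have "\<dots> = ?R\<^sup>2"
    using s by (simp add: power_divide)
  finally have "(\<Sum>j=k..n. c j * \<lfloor>u j\<rfloor>) \<le> (\<Sum>j=k..n. c j * x j)"
    using u0 by (intro optimal_tail [OF opt k]) auto
  then have le: "(\<Sum>j=k..n. real_of_int (c j) * real_of_int \<lfloor>u j\<rfloor>)
      \<le> (\<Sum>j=k..n. real_of_int (c j) * real_of_int (x j))"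
    by (simp only: of_int_mult [symmetric] of_int_sum [symmetric] of_int_le_iff)
  have "?R * ?s - tail_norm1 n c k = ?R / ?s * ?s\<^sup>2 - tail_norm1 n c k"
    using s by (simp add: power2_eq_square)
  also have "\<dots> = (\<Sum>j=k..n. real_of_int (c j) * (u j - 1))"
    unfolding c_sq [symmetric] tail_norm1_def sum_distrib_left sum_subtractf [symmetric]
    using c0 by (intro sum.cong refl) (simp add: u_def power2_eq_square algebra_simps less_imp_le)
  also have "\<dots> \<le> (\<Sum>j=k..n. real_of_int (c j) * real_of_int \<lfloor>u j\<rfloor>)"
  proof (intro sum_mono mult_left_mono)
    show "u j - 1 \<le> real_of_int \<lfloor>u j\<rfloor>" for j
      by linarith
  qed (use c0 less_imp_le in auto)
  finally show ?thesis
    using le by linarith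
qed

theorem theorem6p2:
  fixes n :: nat and c x :: "nat \<Rightarrow> int" and r :: real
  assumes c_pos: "\<forall>j\<in>{1..n}. c j > 0"
    and c_decreasing: "antimono_on {1..n} c"
    and r_sq: "r\<^sup>2 \<in> \<nat>"
    and x_optimal: "optimal n c r x"
  shows "\<forall>k\<in>{1..n}.
      \<bar>real_of_int (x k) - t_star n c r x k\<bar>
        \<le> sqrt (2 * residual_radius r x k * tail_norm1 n c k / tail_norm n c k)
    \<and> sqrt (2 * residual_radius r x k * tail_norm1 n c k / tail_norm n c k)
        \<le> sqrt 2 * sqrt (residual_radius r x k) * (real n - real k + 1) powr (1/4)"
proof (intro ballI conjI)
  fix k assume k: "k \<in> {1..n}"
  let ?R = "residual_radius r x k" and ?s = "tail_norm n c k" and ?N = "tail_norm1 n c k"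
  have feas: "feasible n r x"
    using x_optimal by (simp add: optimal_def is_arg_max_def)
  note R = residual_radius_nonneg [OF feas k]
  \<comment> \<open>A single positive entry bounds the norm from below, which justifies dividing by
    \<open>?s\<close>.\<close>
  have "real_of_int (c k) \<le> ?s"
    unfolding tail_norm_def using k by (intro member_le_L2_set) auto
  then have s: "?s > 0"
    using c_pos k by (smt (verit) of_int_0_less_iff)
  \<comment> \<open>The wanted deviation is the coordinate \<open>k\<close> of the distance between
    the whole tails.\<close>
  have "(real_of_int (x k) - t_star n c r x k)\<^sup>2
      \<le> (\<Sum>j=k..n. (real_of_int (x j) - real_of_int (c j) * ?R / ?s)\<^sup>2)"
    unfolding t_star_def
    by (rule member_le_sum [of k _ "\<lambda>j. (real_of_int (x j) - real_of_int (c j) * ?R / ?s)\<^sup>2"])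
      (use k in auto)
  also have "\<dots> \<le> 2 * ?R * ?N / ?s"
  proof (rule sum_sq_dist_scaled_le [OF s R])
    show "(\<Sum>j=k..n. (real_of_int (c j))\<^sup>2) = ?s\<^sup>2"
      by (simp add: tail_norm_def L2_set_def sum_nonneg)
    show "(\<Sum>j=k..n. (real_of_int (x j))\<^sup>2) \<le> ?R\<^sup>2"
      using tail_sum_sq_le [OF feas k] by (simp add: residual_radius_sq [OF feas k])
    show "?R * ?s - ?N \<le> (\<Sum>j=k..n. real_of_int (c j) * real_of_int (x j))"
      by (rule optimal_tail_ge [OF c_pos x_optimal k s])
  qed
  finally show "\<bar>real_of_int (x k) - t_star n c r x k\<bar> \<le> sqrt (2 * ?R * ?N / ?s)"
    by (metis real_sqrt_abs real_sqrt_le_iff)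
  \<comment> \<open>\<open>m\<close> is the length of the tail; its fourth root arises as the square
    root of the Cauchy--Schwarz factor \<open>sqrt m\<close>.\<close>
  define m where "m = real n - real k + 1"
  have m: "m > 0" "real (card {k..n}) = m"
    using k by (auto simp: m_def of_nat_diff)
  have "?N \<le> sqrt m * ?s"
    using sum_abs_le_sqrt_card_mult_L2_set [of "\<lambda>j. real_of_int (c j)" "{k..n}"] m
    by (simp add: tail_norm1_def tail_norm_def)
  then have "?N / ?s \<le> sqrt m"
    using s by (simp add: field_simps)
  then have "2 * ?R * (?N / ?s) \<le> 2 * ?R * sqrt m"
    using R by (intro mult_left_mono) auto
  then have "sqrt (2 * ?R * ?N / ?s) \<le> sqrt (2 * ?R * sqrt m)"
    by simp
  also have "\<dots> = sqrt 2 * sqrt ?R * m powr (1/4)"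
    using m by (simp add: real_sqrt_mult powr_half_sqrt [symmetric] powr_powr)
  finally show "sqrt (2 * ?R * ?N / ?s) \<le> sqrt 2 * sqrt ?R * (real n - real k + 1) powr (1/4)"
    by (simp add: m_def)
qed

end
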